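(* Let $h_1,\dots,h_N$ be the complex random channel coefficients at the $N$ ports, let $\mathrm{SNR}_{\mathrm{opt}}=\max_{1\le k\le N}|h_k|^2$ have probability density function $f_{\mathrm{opt}}$ on $[0,\infty)$, and let $P_{\mathrm{out}}(\gamma)=\Pr(\mathrm{SNR}_{\mathrm{opt}}<\gamma)$. Then the ergodic capacity $C_{\mathrm{erg}}=\mathbb E[\log_2(1+\mathrm{SNR}_{\mathrm{opt}})]=\int_0^\infty\log_2(1+\gamma)f_{\mathrm{opt}}(\gamma)\,d\gamma$ is $$C_{\mathrm{erg}}=\frac{1}{\ln 2}\int_0^{\infty}\frac{1-P_{\mathrm{out}}(\gamma)}{1+\gamma}\,d\gamma.$$
   Context: A receiver with an $N$-port fluid antenna selects the port with the largest received power. The channel at port $k$ is $h_k=\sum_{p=1}^{P}\alpha_p(\mu_{p,k}+\tilde c_{p,k})$, where $\alpha_p$ are path coefficients, $\mu_{p,k}\in\mathbb C$ are deterministic, and $\tilde c_{p,k}\sim\mathcal{CN}(0,1)$ are zero-mean circularly symmetric complex Gaussian with $\mathbb E[\tilde c_{p,k}\tilde c_{p,l}^{*}]=J_0\left(2\pi\frac{|k-l|}{N-1}W\right)$, $J_0$ being the zeroth-order Bessel function of the first kind and $W>0$ the antenna size in wavelengths. Noise power is normalized to one. *)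

theory Defs
  imports "HOL-Probability.Probability"
begin

definition bessel_J0 :: "real \<Rightarrow> real" where
  "bessel_J0 x = (\<Sum>m. (-1) ^ m / (fact m)\<^sup>2 * (x / 2) ^ (2 * m))"

text \<open>The law CN(0,1): unit total variance, split equally between independent
  real and imaginary parts. The second parameter of \<^const>\<open>normal_density\<close> is the
  standard deviation.\<close>

definition std_complex_gaussian :: "'a measure \<Rightarrow> ('a \<Rightarrow> complex) \<Rightarrow> bool" where
  "std_complex_gaussian M X \<longleftrightarrow>
     distributed M lborel (\<lambda>\<omega>. Re (X \<omega>)) (normal_density 0 (sqrt (1 / 2))) \<and>
     distributed M lborel (\<lambda>\<omega>. Im (X \<omega>)) (normal_density 0 (sqrt (1 / 2))) \<and>
     prob_space.indep_var M borel (\<lambda>\<omega>. Re (X \<omega>)) borel (\<lambda>\<omega>. Im (X \<omega>))"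

definition channel ::
  "nat \<Rightarrow> (nat \<Rightarrow> complex) \<Rightarrow> (nat \<Rightarrow> nat \<Rightarrow> complex) \<Rightarrow> (nat \<Rightarrow> nat \<Rightarrow> 'a \<Rightarrow> complex)
    \<Rightarrow> nat \<Rightarrow> 'a \<Rightarrow> complex" where
  "channel P \<alpha> \<mu> c k \<omega> = (\<Sum>p = 1..P. \<alpha> p * (\<mu> p k + c p k \<omega>))"

definition snr_opt :: "nat \<Rightarrow> (nat \<Rightarrow> 'a \<Rightarrow> complex) \<Rightarrow> 'a \<Rightarrow> real" where
  "snr_opt N h \<omega> = Max ((\<lambda>k. (cmod (h k \<omega>))\<^sup>2) ` {1..N})"

definition outage_prob :: "'a measure \<Rightarrow> ('a \<Rightarrow> real) \<Rightarrow> real \<Rightarrow> real" where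
  "outage_prob M snr \<gamma> = measure M {\<omega> \<in> space M. snr \<omega> < \<gamma>}"

definition ergodic_capacity :: "'a measure \<Rightarrow> ('a \<Rightarrow> real) \<Rightarrow> real" where
  "ergodic_capacity M snr = (\<integral>\<omega>. log 2 (1 + snr \<omega>) \<partial>M)"

end

theory Submission
  imports Defs
begin

text \<open>Since \<open>ln (1 + x)\<close> is the integral of \<open>1 / (1 + t)\<close> over \<open>0 \<le> t \<le> x\<close>, Tonelli's
  theorem turns \<open>E[ln (1 + X)]\<close> into the integral of \<open>Pr(X \<ge> t) / (1 + t)\<close>. It is finite for the
  best port because \<open>ln (1 + x) \<le> x\<close> and the channels, being finite sums of Gaussians, have finite
  second moments.\<close>

lemma nn_integral_inverse_Icc:
  fixes x :: real
  assumes "0 \<le> x"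
  shows "(\<integral>\<^sup>+t. ennreal (1 / (1 + t)) * indicator {0..x} t \<partial>lborel) = ennreal (ln (1 + x))"
proof -
  have "(\<integral>\<^sup>+t. ennreal (1 / (1 + t)) * indicator {0..x} t \<partial>lborel)
      = ennreal (ln (1 + x) - ln (1 + 0))"
    using assms by (intro nn_integral_FTC_Icc) (auto intro!: derivative_eq_intros)
  then show ?thesis by simp
qed

text \<open>Both sides integrate \<open>1 / (1 + t)\<close> over the region under the graph of
  \<open>X\<close>, in the two possible orders. With values in the extended nonnegative reals the
  identity also covers the infinite case, so finiteness of one side passes to the other.\<close>

lemma (in prob_space) nn_integral_ln_one_plus:
  fixes X :: "'a \<Rightarrow> real"
  assumes [measurable]: "X \<in> borel_measurable M"
    and nonneg: "\<And>\<omega>. \<omega> \<in> space M \<Longrightarrow> 0 \<le> X \<omega>"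
  shows "(\<integral>\<^sup>+\<omega>. ennreal (ln (1 + X \<omega>)) \<partial>M)
    = (\<integral>\<^sup>+t. ennreal (indicator {0..} t * ((1 - outage_prob M X t) / (1 + t))) \<partial>lborel)"
proof -
  interpret pair_sigma_finite M lborel ..
  \<comment> \<open>The region is written as a set of pairs, so that joint measurability, required
    for exchanging the integrals, can be derived.\<close>
  let ?g = "\<lambda>\<omega> t. ennreal (1 / (1 + t)) * indicator {(\<omega>, t). 0 \<le> t \<and> t \<le> X \<omega>} (\<omega>, t)"
  have "(\<integral>\<^sup>+\<omega>. ennreal (ln (1 + X \<omega>)) \<partial>M) = (\<integral>\<^sup>+\<omega>. (\<integral>\<^sup>+t. ?g \<omega> t \<partial>lborel) \<partial>M)"
  proof (rule nn_integral_cong)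
    fix \<omega> assume "\<omega> \<in> space M"
    then have "ennreal (ln (1 + X \<omega>))
        = (\<integral>\<^sup>+t. ennreal (1 / (1 + t)) * indicator {0..X \<omega>} t \<partial>lborel)"
      by (simp add: nn_integral_inverse_Icc nonneg)
    also have "\<dots> = (\<integral>\<^sup>+t. ?g \<omega> t \<partial>lborel)"
      by (intro nn_integral_cong) (auto simp: indicator_def)
    finally show "ennreal (ln (1 + X \<omega>)) = (\<integral>\<^sup>+t. ?g \<omega> t \<partial>lborel)" .
  qed
  also have "\<dots> = (\<integral>\<^sup>+t. (\<integral>\<^sup>+\<omega>. ?g \<omega> t \<partial>M) \<partial>lborel)"
    by (rule Fubini'[symmetric]) measurable
  also have "\<dots> = (\<integral>\<^sup>+t. ennreal (indicator {0..} t * ((1 - outage_prob M X t) / (1 + t))) \<partial>lborel)"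
  proof (rule nn_integral_cong)
    fix t :: real
    show "(\<integral>\<^sup>+\<omega>. ?g \<omega> t \<partial>M) = ennreal (indicator {0..} t * ((1 - outage_prob M X t) / (1 + t)))"
    proof (cases "0 \<le> t")
      case True
      \<comment> \<open>Outage is the strict event \<open>X \<omega> < t\<close>, so its complement
        is exactly the closed slice \<open>t \<le> X \<omega>\<close>. The integrands therefore
        agree at every \<open>t\<close>, even where \<open>X\<close> has an atom.\<close>
      have "(\<integral>\<^sup>+\<omega>. ?g \<omega> t \<partial>M)
          = (\<integral>\<^sup>+\<omega>. ennreal (1 / (1 + t)) * indicator {\<omega> \<in> space M. \<not> X \<omega> < t} \<omega> \<partial>M)"
        using True by (intro nn_integral_cong) (auto simp: indicator_def)
      also have "\<dots> = ennreal (1 / (1 + t)) * emeasure M {\<omega> \<in> space M. \<not> X \<omega> < t}"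
        by (rule nn_integral_cmult_indicator) measurable
      also have "\<dots> = ennreal (1 / (1 + t) * prob {\<omega> \<in> space M. \<not> X \<omega> < t})"
        using True by (subst ennreal_mult) (simp_all add: emeasure_eq_measure)
      also have "prob {\<omega> \<in> space M. \<not> X \<omega> < t} = 1 - outage_prob M X t"
        unfolding outage_prob_def by (rule prob_neg) measurable
      finally show ?thesis using True by simp
    qed simp
  qed
  finally show ?thesis .
qed

lemma integrable_cmod_square_mult:
  fixes Z :: "'a \<Rightarrow> complex"
  assumes "integrable M (\<lambda>\<omega>. (cmod (Z \<omega>))\<^sup>2)"
  shows "integrable M (\<lambda>\<omega>. (cmod (a * Z \<omega>))\<^sup>2)"
  using assms by (simp add: norm_mult power_mult_distrib)

text \<open>The triangle inequality and \<open>2 * a * b \<le> a^2 + b^2\<close> bound the square of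
  the sum by twice the sum of the squares.\<close>

lemma integrable_cmod_square_add:
  fixes Y Z :: "'a \<Rightarrow> complex"
  assumes [measurable]: "Y \<in> borel_measurable M" "Z \<in> borel_measurable M"
    and "integrable M (\<lambda>\<omega>. (cmod (Y \<omega>))\<^sup>2)" "integrable M (\<lambda>\<omega>. (cmod (Z \<omega>))\<^sup>2)"
  shows "integrable M (\<lambda>\<omega>. (cmod (Y \<omega> + Z \<omega>))\<^sup>2)"
proof (rule Bochner_Integration.integrable_bound)
  show "integrable M (\<lambda>\<omega>. 2 * (cmod (Y \<omega>))\<^sup>2 + 2 * (cmod (Z \<omega>))\<^sup>2)"
    using assms by simp
  show "AE \<omega> in M. norm ((cmod (Y \<omega> + Z \<omega>))\<^sup>2)
      \<le> norm (2 * (cmod (Y \<omega>))\<^sup>2 + 2 * (cmod (Z \<omega>))\<^sup>2)"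
  proof (rule AE_I2)
    fix \<omega>
    have "(cmod (Y \<omega> + Z \<omega>))\<^sup>2 \<le> (cmod (Y \<omega>) + cmod (Z \<omega>))\<^sup>2"
      by (intro power_mono norm_triangle_ineq) simp
    also have "\<dots> \<le> 2 * (cmod (Y \<omega>))\<^sup>2 + 2 * (cmod (Z \<omega>))\<^sup>2"
      using sum_squares_bound[of "cmod (Y \<omega>)" "cmod (Z \<omega>)"] by (simp add: power2_sum)
    finally show "norm ((cmod (Y \<omega> + Z \<omega>))\<^sup>2)
        \<le> norm (2 * (cmod (Y \<omega>))\<^sup>2 + 2 * (cmod (Z \<omega>))\<^sup>2)" by simp
  qed
qed measurable

lemma integrable_cmod_square_sum:
  fixes Z :: "'i \<Rightarrow> 'a \<Rightarrow> complex"
  assumes "finite I" and "\<And>i. i \<in> I \<Longrightarrow> Z i \<in> borel_measurable M"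
    and "\<And>i. i \<in> I \<Longrightarrow> integrable M (\<lambda>\<omega>. (cmod (Z i \<omega>))\<^sup>2)"
  shows "integrable M (\<lambda>\<omega>. (cmod (\<Sum>i\<in>I. Z i \<omega>))\<^sup>2)"
  using assms
proof (induction I rule: finite_induct)
  case (insert i I)
  have "integrable M (\<lambda>\<omega>. (cmod (Z i \<omega> + (\<Sum>i\<in>I. Z i \<omega>)))\<^sup>2)"
    using insert by (intro integrable_cmod_square_add borel_measurable_sum) auto
  then show ?case using insert.hyps by simp
qed simp

lemma distributed_normal_integrable_square:
  assumes "distributed M lborel X (normal_density 0 \<sigma>)" and "0 < \<sigma>"
  shows "integrable M (\<lambda>\<omega>. (X \<omega>)\<^sup>2)"
  \<comment> \<open>As the mean is 0, the second central moment of the normal density is the plain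
    second moment.\<close>
  using distributed_integrable[OF assms(1), of "\<lambda>x. x\<^sup>2"]
    integrable_normal_moment[OF assms(2), of 0 2]
  by simp

lemma std_complex_gaussian_measurable:
  assumes "std_complex_gaussian M X"
  shows "X \<in> borel_measurable M"
  using assms
  by (simp add: std_complex_gaussian_def borel_measurable_complex_iff distributed_def)

lemma std_complex_gaussian_integrable_cmod_square:
  assumes "std_complex_gaussian M X"
  shows "integrable M (\<lambda>\<omega>. (cmod (X \<omega>))\<^sup>2)"
  using assms distributed_normal_integrable_square[of M _ "sqrt (1 / 2)"]
  by (simp add: std_complex_gaussian_def cmod_power2)

text \<open>Each summand is a scalar multiple of a constant plus a Gaussian. The constant is square
  integrable because the measure is finite.\<close>

lemma (in prob_space) channel_integrable_cmod_square:
  assumes "\<And>p. p \<in> {1..P} \<Longrightarrow> std_complex_gaussian M (c p k)"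
  shows "integrable M (\<lambda>\<omega>. (cmod (channel P \<alpha> \<mu> c k \<omega>))\<^sup>2)"
  unfolding channel_def
proof (intro integrable_cmod_square_sum integrable_cmod_square_mult integrable_cmod_square_add
    borel_measurable_times borel_measurable_add borel_measurable_const)
  fix p assume "p \<in> {1..P}"
  note g = assms[OF this]
  \<comment> \<open>The same goal arises twice: from measurability of the summand and from the rule
    for adding \<open>\<mu> p k\<close>.\<close>
  show "c p k \<in> borel_measurable M" "c p k \<in> borel_measurable M"
    using g by (rule std_complex_gaussian_measurable)+
  show "integrable M (\<lambda>\<omega>. (cmod (c p k \<omega>))\<^sup>2)"
    using g by (rule std_complex_gaussian_integrable_cmod_square)
qed simp_all

text \<open>At least one port is required, since \<open>Max\<close> of the empty set is
  unspecified.\<close>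

lemma snr_opt_nonneg:
  assumes "1 \<le> N"
  shows "0 \<le> snr_opt N h \<omega>"
  unfolding snr_opt_def using assms by (subst Max_ge_iff) auto

text \<open>A sum of nonnegative terms dominates each of them; this supplies an integrable majorant
  for the maximum.\<close>

lemma snr_opt_le_sum:
  assumes "1 \<le> N"
  shows "snr_opt N h \<omega> \<le> (\<Sum>k = 1..N. (cmod (h k \<omega>))\<^sup>2)"
  unfolding snr_opt_def using assms by (subst Max_le_iff) (auto intro!: member_le_sum)

lemma (in prob_space) integrable_snr_opt:
  assumes "1 \<le> N" and "snr_opt N h \<in> borel_measurable M"
    and "\<And>k. k \<in> {1..N} \<Longrightarrow> integrable M (\<lambda>\<omega>. (cmod (h k \<omega>))\<^sup>2)"
  shows "integrable M (snr_opt N h)"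
proof (rule Bochner_Integration.integrable_bound)
  show "integrable M (\<lambda>\<omega>. \<Sum>k = 1..N. (cmod (h k \<omega>))\<^sup>2)"
    using assms(3) by (rule Bochner_Integration.integrable_sum)
  show "AE \<omega> in M. norm (snr_opt N h \<omega>) \<le> norm (\<Sum>k = 1..N. (cmod (h k \<omega>))\<^sup>2)"
    using snr_opt_nonneg[OF assms(1), of h] snr_opt_le_sum[OF assms(1), of h]
    by (simp add: sum_nonneg)
qed (rule assms(2))

lemma integrable_ln_one_plus:
  fixes X :: "'a \<Rightarrow> real"
  assumes "integrable M X" and "\<And>\<omega>. 0 \<le> X \<omega>"
  shows "integrable M (\<lambda>\<omega>. ln (1 + X \<omega>))"
proof (rule Bochner_Integration.integrable_bound[OF assms(1)])
  show "(\<lambda>\<omega>. ln (1 + X \<omega>)) \<in> borel_measurable M"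
    using borel_measurable_integrable[OF assms(1)] by measurable
  show "AE \<omega> in M. norm (ln (1 + X \<omega>)) \<le> norm (X \<omega>)"
    using assms(2) by (auto simp: ln_add_one_self_le_self)
qed

theorem lemma3:
  fixes M :: "'a measure" and N P :: nat and W :: real
    and \<alpha> :: "nat \<Rightarrow> complex" and \<mu> :: "nat \<Rightarrow> nat \<Rightarrow> complex"
    and c :: "nat \<Rightarrow> nat \<Rightarrow> 'a \<Rightarrow> complex"
    and h :: "nat \<Rightarrow> 'a \<Rightarrow> complex"
    and f_opt :: "real \<Rightarrow> real"
  assumes "prob_space M"
    and "N \<ge> 1" and "W > 0"
    and "\<And>p k. p \<in> {1..P} \<Longrightarrow> k \<in> {1..N} \<Longrightarrow> std_complex_gaussian M (c p k)"
    and "\<And>p k l. p \<in> {1..P} \<Longrightarrow> k \<in> {1..N} \<Longrightarrow> l \<in> {1..N} \<Longrightarrow>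
           (\<integral>\<omega>. c p k \<omega> * cnj (c p l \<omega>) \<partial>M)
             = complex_of_real (bessel_J0 (2 * pi * (\<bar>real k - real l\<bar> / (real N - 1)) * W))"
    and "\<And>k. k \<in> {1..N} \<Longrightarrow> h k = channel P \<alpha> \<mu> c k"
    and "\<And>\<gamma>. \<gamma> \<ge> 0 \<Longrightarrow> f_opt \<gamma> \<ge> 0"
    and "distributed M lborel (snr_opt N h) (\<lambda>\<gamma>. ennreal (indicator {0..} \<gamma> * f_opt \<gamma>))"
  shows "integrable M (\<lambda>\<omega>. log 2 (1 + snr_opt N h \<omega>))
    \<and> set_integrable lborel {0..} (\<lambda>\<gamma>. log 2 (1 + \<gamma>) * f_opt \<gamma>)
    \<and> set_integrable lborel {0..} (\<lambda>\<gamma>. (1 - outage_prob M (snr_opt N h) \<gamma>) / (1 + \<gamma>))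
    \<and> ergodic_capacity M (snr_opt N h) = (LINT \<gamma>:{0..}|lborel. log 2 (1 + \<gamma>) * f_opt \<gamma>)
    \<and> ergodic_capacity M (snr_opt N h)
        = 1 / ln 2 * (LINT \<gamma>:{0..}|lborel. (1 - outage_prob M (snr_opt N h) \<gamma>) / (1 + \<gamma>))"
proof -
  interpret prob_space M by fact
  let ?X = "snr_opt N h"
  let ?Q = "\<lambda>t. (1 - outage_prob M ?X t) / (1 + t)"
  \<comment> \<open>Having a density includes being measurable.\<close>
  have X [measurable]: "?X \<in> borel_measurable M"
    using assms(8) by (simp add: distributed_def)
  have nonneg: "0 \<le> ?X \<omega>" for \<omega>
    using assms(2) by (rule snr_opt_nonneg)
  have "integrable M ?X"
    using assms(2,4,6) X by (intro integrable_snr_opt) (auto intro: channel_integrable_cmod_square)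
  then have ln_int: "integrable M (\<lambda>\<omega>. ln (1 + ?X \<omega>))"
    using nonneg by (rule integrable_ln_one_plus)
  then have log_int: "integrable M (\<lambda>\<omega>. log 2 (1 + ?X \<omega>))"
    by (simp add: log_def)

  \<comment> \<open>The change of variables to the density asks for nonnegativity on the whole line,
    whereas \<open>f_opt\<close> is controlled only on the half-line; the indicator bridges
    this.\<close>
  have dens_nonneg: "0 \<le> indicator {0..} \<gamma> * f_opt \<gamma>" for \<gamma> :: real
    using assms(7) by (simp add: indicator_def)
  have dens_int: "set_integrable lborel {0..} (\<lambda>\<gamma>. log 2 (1 + \<gamma>) * f_opt \<gamma>)"
    using log_int distributed_integrable[OF assms(8), of "\<lambda>\<gamma>. log 2 (1 + \<gamma>)"] dens_nonneg
    by (simp add: set_integrable_def mult_ac)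
  have dens_eq: "ergodic_capacity M ?X = (LINT \<gamma>:{0..}|lborel. log 2 (1 + \<gamma>) * f_opt \<gamma>)"
    using distributed_integral[OF assms(8), of "\<lambda>\<gamma>. log 2 (1 + \<gamma>)"] dens_nonneg
    by (simp add: ergodic_capacity_def set_lebesgue_integral_def mult_ac)

  have Q_nonneg: "0 \<le> indicator {0..} t * ?Q t" for t :: real
    by (simp add: indicator_def outage_prob_def)
  \<comment> \<open>A distribution function is monotone, hence Borel measurable.\<close>
  have "mono (outage_prob M ?X)"
    unfolding outage_prob_def by (intro monoI finite_measure_mono) auto
  then have [measurable]: "outage_prob M ?X \<in> borel_measurable borel"
    by (rule borel_measurable_mono)
  \<comment> \<open>The right-hand side is a finite number because
    \<open>ln (1 + ?X \<omega>)\<close> is integrable. This one equation yields both the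
    integrability of \<open>?Q\<close> on the half-line and the value of its integral.\<close>
  have nn: "(\<integral>\<^sup>+t. ennreal (indicator {0..} t * ?Q t) \<partial>lborel)
      = ennreal (\<integral>\<omega>. ln (1 + ?X \<omega>) \<partial>M)"
    using nn_integral_eq_integral[OF ln_int] nn_integral_ln_one_plus[OF X] nonneg by simp
  have Q: "integrable lborel (\<lambda>t. indicator {0..} t * ?Q t)"
    using Q_nonneg nn by (intro integrableI_nonneg) simp_all
  have "(\<integral>t. indicator {0..} t * ?Q t \<partial>lborel) = (\<integral>\<omega>. ln (1 + ?X \<omega>) \<partial>M)"
    using nn Q_nonneg nonneg by (subst integral_eq_nn_integral) simp_all
  \<comment> \<open>The factor \<open>1 / ln 2\<close> converts the natural logarithm to base
    2.\<close>
  then have "ergodic_capacity M ?X = 1 / ln 2 * (LINT t:{0..}|lborel. ?Q t)"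
    by (simp add: ergodic_capacity_def set_lebesgue_integral_def log_def)
  with Q log_int dens_int dens_eq show ?thesis
    by (simp add: set_integrable_def)
qed

end
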